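(* Let $0<\beta\le 1/2$ and $\delta:=18\beta$. Then $\mathbf{Bad}(\delta)$ is a $(1/2,\beta)$-ubiquitously losing set of $\mathbb{R}$.
   Context: For $\delta>0$, $\mathbf{Bad}(\delta)$ denotes the set of irrational real numbers $x$ for which there exists an integer $Q>0$ (depending on $x$) such that $|x-p/q|\ge \delta/q^2$ for all integers $q\ge Q$ and all integers $p$ coprime to $q$. Schmidt game: for a closed ball $B$ (positive radius, radius denoted $\rho(B)$) and $0<\gamma\le 1$, let $B^\gamma$ be the collection of closed balls $\widetilde B\subset B$ with $\rho(\widetilde B)=\gamma\rho(B)$. For $S\subset\mathbb{R}^d$ and $0<\alpha,\beta<1$, in the $(\alpha,\beta;S)$-game Bob chooses a closed ball $B_1$, and then, for $n\ge1$, Alice chooses $A_n\in B_n^\alpha$ and Bob chooses $B_{n+1}\in A_n^\beta$. The intersection $\bigcap_{n} B_n$ is a single point. $S$ is an $(\alpha,\beta)$-ubiquitously losing set of $\mathbb{R}^d$ if, for every choice of closed ball $B_1$, Bob has a strategy for the game with initial ball $B_1$ ensuring, whatever Alice plays, that this point lies in the complement $S^c$. Here $d=1$ and closed balls are closed bounded intervals of positive length. *)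

theory Defs
  imports "HOL-Analysis.Analysis"
begin

definition Bad :: "real \<Rightarrow> real set" where
  "Bad \<delta> = {x. x \<notin> \<rat> \<and>
     (\<exists>Q::int. Q > 0 \<and> (\<forall>q p :: int. q \<ge> Q \<and> coprime p q \<longrightarrow>
        \<bar>x - real_of_int p / real_of_int q\<bar> \<ge> \<delta> / (real_of_int q)\<^sup>2))}"

definition is_closed_ball :: "'a::euclidean_space set \<Rightarrow> bool" where
  "is_closed_ball B \<longleftrightarrow> (\<exists>c r. 0 < r \<and> B = cball c r)"

text \<open>The collection written \<open>B\<^sup>\<gamma>\<close> in the literature. In a Euclidean space a closed ball of
  positive radius determines its radius, so \<open>r\<close> below is the radius of \<open>B\<close>.\<close>

definition sub_balls :: "real \<Rightarrow> 'a::euclidean_space set \<Rightarrow> 'a set set" where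
  "sub_balls \<gamma> B = {B'. B' \<subseteq> B \<and> (\<exists>c r c'. 0 < r \<and> B = cball c r \<and> B' = cball c' (\<gamma> * r))}"

text \<open>Rounds are numbered from 0: \<open>B 0\<close> is Bob's initial ball and, in round \<open>n\<close>, Alice answers
  \<open>B n\<close> with \<open>A n\<close>. A strategy of Bob maps the nonempty list of Alice's moves so far to his next
  ball; his own earlier moves are determined by that list, so this loses no information.\<close>

definition bob_ball ::
  "'a::euclidean_space set \<Rightarrow> ('a set list \<Rightarrow> 'a set) \<Rightarrow> (nat \<Rightarrow> 'a set) \<Rightarrow> nat \<Rightarrow> 'a set" where
  "bob_ball B\<^sub>1 \<sigma> A n = (if n = 0 then B\<^sub>1 else \<sigma> (map A [0..<n]))"

text \<open>Legality is required after every finite legal play of Alice, and not only along infinite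
  plays: otherwise Bob could win vacuously by an illegal move that leaves Alice no legal answer.\<close>

definition bob_legal ::
  "real \<Rightarrow> real \<Rightarrow> 'a::euclidean_space set \<Rightarrow> ('a set list \<Rightarrow> 'a set) \<Rightarrow> bool" where
  "bob_legal \<alpha> \<beta> B\<^sub>1 \<sigma> \<longleftrightarrow>
     (\<forall>A n. (\<forall>k\<le>n. A k \<in> sub_balls \<alpha> (bob_ball B\<^sub>1 \<sigma> A k)) \<longrightarrow>
        bob_ball B\<^sub>1 \<sigma> A (Suc n) \<in> sub_balls \<beta> (A n))"

definition ubiquitously_losing :: "real \<Rightarrow> real \<Rightarrow> 'a::euclidean_space set \<Rightarrow> bool" where
  "ubiquitously_losing \<alpha> \<beta> S \<longleftrightarrow>
     (\<forall>B\<^sub>1. is_closed_ball B\<^sub>1 \<longrightarrow>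
       (\<exists>\<sigma>. bob_legal \<alpha> \<beta> B\<^sub>1 \<sigma> \<and>
         (\<forall>A. (\<forall>n. A n \<in> sub_balls \<alpha> (bob_ball B\<^sub>1 \<sigma> A n)) \<longrightarrow>
            (\<exists>x. (\<Inter>n. bob_ball B\<^sub>1 \<sigma> A n) = {x} \<and> x \<in> - S))))"

end

theory Submission imports Defs begin

text \<open>Whenever Alice's interval \<open>A\<close> of radius \<open>r\<close> contains some \<open>p / q\<close> with \<open>q\<^sup>2 r < 9\<close>, Bob plays an
  interval containing it, which puts the final point within \<open>2 \<beta> r < 18 \<beta> / q\<^sup>2\<close> of \<open>p / q\<close>. Otherwise
  he centres his interval at the fraction \<open>P / Q\<close> of least denominator among the admissible centres.
  Were the first case to occur only finitely often, then, since \<open>P / Q\<close> lies in Alice's next interval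
  (its radius is exactly half of Bob's), eventually \<open>9 \<le> Q\<^sup>2 \<beta> r / 2\<close>. On the other hand one of
  the Farey neighbours \<open>p / q\<close> of \<open>P / Q\<close> is at distance at least \<open>(1 - \<beta>) r\<close>, and the fractions
  \<open>(P + m p) / (Q + m q)\<close> are dense enough that the next least denominator is at most \<open>2 Q\<close>. So
  \<open>Q\<^sup>2 r\<close> is multiplied by at most \<open>2 \<beta> < 1\<close> in each round, a contradiction. This works for
  \<open>\<beta> \<le> 1/3\<close>; for larger \<open>\<beta>\<close> the set is empty by Dirichlet's theorem.\<close>

section \<open>Fractions of least denominator in an interval\<close>

lemma reduced_fraction:
  fixes p q :: int
  assumes "0 < q"
  obtains a b :: int where "0 < b" "b \<le> q" "coprime a b"
    "real_of_int a / real_of_int b = real_of_int p / real_of_int q"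
proof -
  have "gcd p q \<noteq> 0" "0 \<le> gcd p q" using assms by auto
  then obtain a b g where g: "0 < g" and p: "p = a * g" and q: "q = b * g" and "coprime a b"
    using gcd_coprime_exists[of p q] by (metis order_le_less)
  have "0 < b" using q assms g by (simp add: zero_less_mult_iff)
  moreover have "b * 1 \<le> b * g" using \<open>0 < b\<close> g by (intro mult_left_mono) linarith+
  moreover have "real_of_int a / real_of_int b = real_of_int p / real_of_int q"
    using g by (simp add: p q)
  ultimately show thesis using that \<open>coprime a b\<close> q by simp
qed

text \<open>Minimality ranges over all pairs \<open>p'\<close>, \<open>q'\<close>, coprime or not,
  so the fractions constructed below can be compared with \<open>q\<close> without being reduced
  first.\<close>

definition least_fraction_in :: "real set \<Rightarrow> int \<Rightarrow> int \<Rightarrow> bool" where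
  "least_fraction_in I p q \<longleftrightarrow> 0 < q \<and> coprime p q \<and> real_of_int p / real_of_int q \<in> I \<and>
     (\<forall>p' q'. 0 < q' \<and> real_of_int p' / real_of_int q' \<in> I \<longrightarrow> q \<le> q')"

lemma least_fraction_exists:
  assumes "0 < s"
  obtains p q where "least_fraction_in (cball c s) p q"
proof -
  define D where "D n \<longleftrightarrow> 0 < n \<and> (\<exists>p::int. real_of_int p / real n \<in> cball c s)" for n :: nat
  obtain y where y: "y \<in> \<rat>" "c < y" "y < c + s"
    using Rats_dense_in_real[of c "c + s"] assms by auto
  obtain a b :: int where "0 < b" "y = a / b"
    using y(1) by (meson Rats_cases')
  then have "D (nat b)"
    unfolding D_def using y by (auto simp: dist_real_def intro!: exI[of _ a])
  then have L: "D (LEAST n. D n)" by (rule LeastI)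
  define n where "n = (LEAST n. D n)"
  obtain p0 :: int where n: "0 < n" "real_of_int p0 / real n \<in> cball c s"
    using L unfolding D_def n_def by auto
  have min: "int n \<le> q'" if "0 < q'" "real_of_int p' / real_of_int q' \<in> cball c s" for p' q'
  proof -
    have "D (nat q')" unfolding D_def using that by auto
    then have "n \<le> nat q'" unfolding n_def by (rule Least_le)
    then show ?thesis using that by linarith
  qed
  obtain p q where "0 < q" "q \<le> int n" "coprime p q" "real_of_int p / real_of_int q = p0 / int n"
    using reduced_fraction[of "int n" p0] n by (metis of_nat_0_less_iff)
  then have "least_fraction_in (cball c s) p q"
    unfolding least_fraction_in_def using n min by fastforce
  then show thesis by (rule that)
qed

section \<open>Farey neighbours and mediants\<close>

text \<open>Take a Bezout coefficient of \<open>P\<close> modulo \<open>Q\<close>; residue 0 would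
  make \<open>Q\<close> a unit. This is the left neighbour; the right one is later obtained as
  \<open>(P - p) / (Q - q)\<close>.\<close>

lemma farey_neighbours:
  fixes P Q :: int
  assumes "coprime P Q" "2 \<le> Q"
  obtains p q :: int where "0 < q" "q < Q" "P * q - p * Q = 1"
proof -
  obtain u v where uv: "u * P + v * Q = 1"
    using bezout_int[of P Q] assms(1) by auto
  define q where "q = u mod Q"
  have "q = u - Q * (u div Q)" unfolding q_def by (rule minus_mult_div_eq_mod[symmetric])
  then have "P * q = u * P - Q * (P * (u div Q))"
    by (simp only: right_diff_distrib mult.commute mult.left_commute)
  then have "P * q - 1 = Q * (- v - P * (u div Q))" using uv by (simp add: algebra_simps)
  then obtain p where p: "P * q - 1 = Q * p" by blast
  have "q \<noteq> 0"
  proof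
    assume "q = 0"
    then have "1 = Q * (- p)" using p by simp
    then have "Q dvd 1" by (rule dvdI)
    then show False using assms(2) zdvd_imp_le[of Q 1] by simp
  qed
  moreover have "0 \<le> q" "q < Q" unfolding q_def using assms by auto
  ultimately show thesis using that[of q p] p by (simp add: algebra_simps)
qed

text \<open>The fractions \<open>(P + m p) / (Q + m q)\<close> accumulate at \<open>p / q\<close>, and near \<open>P / Q\<close> their gaps
  are of order \<open>1 / Q\<^sup>2\<close>.\<close>

lemma mediant_in_interval:
  fixes P Q p q :: int and c s :: real
  assumes q: "0 < q" and Q: "0 < Q" and det: "P * q - p * Q = 1"
    and near: "\<bar>c - P / Q\<bar> + s \<le> (1 / (real_of_int q * real_of_int Q)) / 2"
    and long: "9 / (4 * (real_of_int Q)\<^sup>2) \<le> 2 * s"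
  obtains u w :: int where "0 < w" "w \<le> 2 * Q" "real_of_int u / real_of_int w \<in> cball c s"
proof -
  have rq: "0 < real_of_int q" "0 < real_of_int Q" using q Q by auto
  have rdet: "real_of_int P * q - p * Q = 1" using det by (metis of_int_1 of_int_diff of_int_mult)
  have PQ: "P / Q = p / q + 1 / (real_of_int q * Q)"
    using rdet rq by (simp add: field_simps)
  \<comment> \<open>The endpoints of the interval and, as \<open>d\<close>, the point
    \<open>P / Q\<close>, all measured from \<open>p / q\<close>. By \<open>near\<close>, the
    interval then lies between \<open>d / 2\<close> and \<open>3/2 * d\<close>.\<close>
  define a where "a = c - s - p / q"
  define b where "b = c + s - p / q"
  define d where "d = 1 / (real_of_int q * Q)"
  have d: "0 < d" unfolding d_def using rq by simp
  have near': "\<bar>c - P / Q\<bar> + s \<le> d / 2" using near unfolding d_def .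
  have "0 < 9 / (4 * (real_of_int Q)\<^sup>2)" using rq by simp
  then have s: "0 < s" using long by linarith
  have a: "d / 2 \<le> a" and b: "b \<le> 3/2 * d" and ab: "b - a = 2 * s"
    using near' PQ[folded d_def] d unfolding a_def b_def by linarith+
  have pos: "0 < a" "0 < b" "a < b" using a d s ab by linarith+
  \<comment> \<open>For \<open>w > 0\<close>, the point \<open>p / q + 1 / (q * w)\<close> lies in
    the interval iff \<open>w\<close> is between \<open>1 / (q * b)\<close> and
    \<open>1 / (q * a)\<close>. This range turns out to have length at least \<open>q\<close>, so it
    meets the residue class of \<open>Q\<close> modulo \<open>q\<close>. The 9/4 in
    \<open>long\<close> is the square of the 3/2 bounding \<open>b\<close>.\<close>
  have "q * (a * b) * q \<le> q * ((3/2 * d) * (3/2 * d)) * q"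
    using pos b rq by (intro mult_right_mono mult_left_mono mult_mono) auto
  also have "\<dots> = 9 / (4 * (real_of_int Q)\<^sup>2)"
    unfolding d_def using rq by (simp add: power2_eq_square field_simps)
  finally have gap: "q * (a * b) * q \<le> b - a" using long ab by linarith
  then have gap: "q \<le> 1 / (q * a) - 1 / (q * b)"
    using pos rq by (simp add: field_simps)
  \<comment> \<open>The largest \<open>m\<close> with \<open>Q + m * q \<le> 1 / (q * a)\<close>. It
    may be negative; positivity of \<open>w\<close> comes from
    \<open>1 / (q * b) \<le> w\<close>.\<close>
  define m where "m = \<lfloor>(1 / (q * a) - Q) / q\<rfloor>"
  define w where "w = Q + m * q"
  have "real_of_int m \<le> (1 / (q * a) - Q) / q" "(1 / (q * a) - Q) / q < real_of_int m + 1"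
    unfolding m_def by linarith+
  then have m: "real_of_int m * q \<le> 1 / (q * a) - Q" "1 / (q * a) - Q < (real_of_int m + 1) * q"
    using rq by (simp_all only: pos_le_divide_eq pos_divide_less_eq)
  have w_le: "real_of_int w \<le> 1 / (q * a)" and w_ge: "1 / (q * b) \<le> real_of_int w"
    using m gap unfolding w_def by (auto simp: algebra_simps)
  have w0: "0 < real_of_int w" using w_ge pos rq by (smt (verit) divide_pos_pos mult_pos_pos)
  have "1 / (q * a) \<le> 1 / (q * (d / 2))"
    using a d rq pos by (intro divide_left_mono mult_left_mono mult_pos_pos) auto
  also have "\<dots> = 2 * Q" unfolding d_def using rq by (simp add: field_simps)
  finally have w2: "w \<le> 2 * Q" using w_le by linarith
  define u where "u = P + m * p"
  have "u * q = p * w + 1" using det unfolding u_def w_def by (simp add: algebra_simps)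
  then have "real_of_int u * q = p * w + 1" by (metis of_int_1 of_int_add of_int_mult)
  then have uw: "u / w = p / q + 1 / (q * real_of_int w)"
    using w0 rq by (simp add: field_simps)
  have "a \<le> 1 / (q * real_of_int w)" "1 / (q * real_of_int w) \<le> b"
    using w_le w_ge w0 rq pos by (simp_all add: field_simps)
  then have "real_of_int u / w \<in> cball c s"
    using uw unfolding a_def b_def by (auto simp: dist_real_def abs_if)
  then show thesis using that[of w u] w0 w2 by simp
qed

text \<open>The Farey neighbour on the same side of \<open>P / Q\<close> as \<open>c\<close> has a
  smaller denominator, so it lies outside \<open>cball c \<eta>\<close>, beyond the far endpoint.
  Its distance to \<open>P / Q\<close>, the reciprocal of the product of the denominators, therefore
  exceeds \<open>\<eta>\<close>, and the mediants based at it apply.\<close>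

lemma fraction_in_adjacent_interval:
  fixes P Q :: int and c r c' s \<eta> :: real
  assumes least: "least_fraction_in (cball c \<eta>) P Q" and "2 \<le> Q"
    and near: "\<bar>c' - P / Q\<bar> + s \<le> \<eta> / 2"
    and long: "9 / (4 * (real_of_int Q)\<^sup>2) \<le> 2 * s"
  obtains u w :: int where "0 < w" "w \<le> 2 * Q" "real_of_int u / real_of_int w \<in> cball c' s"
proof -
  have Q: "0 < Q" "coprime P Q" and mem: "\<bar>c - P / Q\<bar> \<le> \<eta>"
    and min: "\<And>p' q'. 0 < q' \<Longrightarrow> q' < Q \<Longrightarrow> \<not> \<bar>c - real_of_int p' / real_of_int q'\<bar> \<le> \<eta>"
    using least unfolding least_fraction_in_def by (force simp: dist_real_def)+
  obtain p q where q: "0 < q" "q < Q" and det: "P * q - p * Q = 1"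
    using farey_neighbours Q(2) \<open>2 \<le> Q\<close> by blast
  \<comment> \<open>The right neighbour. Reflected in 0 it becomes the left neighbour of
    \<open>- P / Q\<close>, as \<open>det'\<close> records.\<close>
  define p' q' where "p' = P - p" and "q' = Q - q"
  have q': "0 < q'" "q' < Q" and det': "(- P) * q' - (- p') * Q = 1"
    using q det unfolding p'_def q'_def by (auto simp: algebra_simps)
  have rdet: "real_of_int P * q - p * Q = 1" using det by (metis of_int_1 of_int_diff of_int_mult)
  have rdet': "- (real_of_int P * q') + p' * Q = 1"
    using det' by (metis (no_types, opaque_lifting) diff_minus_eq_add minus_mult_left of_int_1 of_int_add of_int_minus of_int_mult)
  have left: "P / Q - p / q = 1 / (real_of_int q * Q)"
    using rdet q Q by (simp add: field_simps)
  have right: "p' / q' - P / Q = 1 / (real_of_int q' * Q)"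
    using rdet' q' Q by (simp add: field_simps)
  have pos: "0 < 1 / (real_of_int q * Q)" "0 < 1 / (real_of_int q' * Q)"
    using q q' Q by auto
  have out: "\<not> \<bar>c - p / q\<bar> \<le> \<eta>" "\<not> \<bar>c - p' / q'\<bar> \<le> \<eta>"
    using min q q' by auto
  consider "c \<le> P / Q" | "P / Q \<le> c" by linarith
  then show thesis
  proof cases
    case 1
    then have "\<eta> \<le> 1 / (real_of_int q * Q)"
      using out(1) left pos(1) mem by linarith
    then have "\<eta> / 2 \<le> (1 / (real_of_int q * Q)) / 2" by (rule divide_right_mono) simp
    with near have "\<bar>c' - P / Q\<bar> + s \<le> (1 / (real_of_int q * Q)) / 2" by (rule order_trans)
    then show thesis using mediant_in_interval[OF q(1) Q(1) det _ long] that by blast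
  next
    case 2
    then have "\<eta> \<le> 1 / (real_of_int q' * Q)"
      using out(2) right pos(2) mem by linarith
    then have "\<eta> / 2 \<le> (1 / (real_of_int q' * Q)) / 2" by (rule divide_right_mono) simp
    with near have "\<bar>c' - P / Q\<bar> + s \<le> (1 / (real_of_int q' * Q)) / 2" by (rule order_trans)
    moreover have "\<bar>(- c') - real_of_int (- P) / Q\<bar> = \<bar>c' - P / Q\<bar>" by simp
    ultimately have nr: "\<bar>(- c') - real_of_int (- P) / Q\<bar> + s \<le> (1 / (real_of_int q' * Q)) / 2" by metis
    then obtain u w :: int where "0 < w" "w \<le> 2 * Q" "real_of_int u / w \<in> cball (- c') s"
      using mediant_in_interval[OF q'(1) Q(1) det' nr long] by blast
    moreover have "dist (- c') (u / w) = dist c' (real_of_int (- u) / w)"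
      by (simp add: dist_real_def)
    ultimately show thesis using that[of w "- u"] by simp
  qed
qed

section \<open>Bob's reply in a single round\<close>

text \<open>Here \<open>c\<close> and \<open>r\<close> belong to Alice's ball, and
  \<open>cball c ((1 - \<beta>) * r)\<close> is the set of admissible centres for Bob. The clause
  \<open>9 \<le> (real_of_int q)\<^sup>2 * r\<close> serves to bound the denominator of Bob's
  preceding centre, which Alice's ball still contains.\<close>

definition good_reply :: "real \<Rightarrow> real \<Rightarrow> real \<Rightarrow> real set \<Rightarrow> bool" where
  "good_reply \<beta> c r B \<longleftrightarrow>
     (\<exists>p q::int. 0 < q \<and> coprime p q \<and> (real_of_int q)\<^sup>2 * r < 9 \<and>
        real_of_int p / real_of_int q \<in> B) \<or>
     (\<forall>p q::int. 0 < q \<and> real_of_int p / real_of_int q \<in> cball c r \<longrightarrow> 9 \<le> (real_of_int q)\<^sup>2 * r) \<and>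
     (\<exists>p q. least_fraction_in (cball c ((1 - \<beta>) * r)) p q \<and>
        B = cball (real_of_int p / real_of_int q) (\<beta> * r))"

lemma sub_balls_cball:
  fixes c c' r :: real
  assumes "0 < r" "0 < \<gamma>"
  shows "cball c' (\<gamma> * r) \<in> sub_balls \<gamma> (cball c r) \<longleftrightarrow> \<bar>c' - c\<bar> \<le> (1 - \<gamma>) * r"
proof -
  have "0 \<le> \<gamma> * r" using assms by simp
  then have "cball c' (\<gamma> * r) \<subseteq> cball c r \<longleftrightarrow> \<bar>c' - c\<bar> \<le> (1 - \<gamma>) * r"
    by (auto simp: cball_subset_cball_iff dist_real_def algebra_simps)
  then show ?thesis using assms unfolding sub_balls_def by auto
qed

lemma sub_ballsE:
  fixes c r :: real
  assumes "B \<in> sub_balls \<gamma> (cball c r)" "0 < r"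
  obtains c' where "B = cball c' (\<gamma> * r)"
  using assms unfolding sub_balls_def by (auto simp: cball_eq_cball_iff)

lemma good_reply_exists:
  assumes "0 < r" "0 < \<beta>" "\<beta> < 1"
  obtains B where "B \<in> sub_balls \<beta> (cball c r)" "good_reply \<beta> c r B"
proof (cases "\<exists>p q::int. 0 < q \<and> real_of_int p / real_of_int q \<in> cball c r \<and> (real_of_int q)\<^sup>2 * r < 9")
  case True
  then obtain p0 q0 :: int where pq0: "0 < q0" "real_of_int p0 / real_of_int q0 \<in> cball c r"
    "(real_of_int q0)\<^sup>2 * r < 9" by auto
  \<comment> \<open>\<open>Bad\<close> constrains coprime pairs only, and passing to a smaller
    denominator preserves the bound 9.\<close>
  obtain p q :: int where pq: "0 < q" "q \<le> q0" "coprime p q"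
    "real_of_int p / real_of_int q = real_of_int p0 / real_of_int q0"
    using reduced_fraction[OF pq0(1)] by metis
  have "(real_of_int q)\<^sup>2 * r \<le> (real_of_int q0)\<^sup>2 * r"
    using pq assms by (intro mult_right_mono power_mono) auto
  then have q9: "(real_of_int q)\<^sup>2 * r < 9" using pq0 by linarith
  define z where "z = real_of_int p / real_of_int q"
  have z: "\<bar>z - c\<bar> \<le> r" using pq0(2) pq(4) by (simp add: z_def dist_real_def abs_minus_commute)
  \<comment> \<open>Moving the proportion \<open>1 - \<beta>\<close> of the way from
    \<open>c\<close> to \<open>z\<close> stays within \<open>(1 - \<beta>) * r\<close> of
    \<open>c\<close>, which is legal, and comes within \<open>\<beta> * r\<close> of
    \<open>z\<close>.\<close>
  define c' where "c' = c + (1 - \<beta>) * (z - c)"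
  have "\<bar>c' - c\<bar> = (1 - \<beta>) * \<bar>z - c\<bar>" using assms by (simp add: c'_def abs_mult)
  also have "\<dots> \<le> (1 - \<beta>) * r" using z assms by (intro mult_left_mono) auto
  finally have sub: "cball c' (\<beta> * r) \<in> sub_balls \<beta> (cball c r)"
    using sub_balls_cball assms by simp
  have "c' - z = \<beta> * (c - z)" by (simp add: c'_def algebra_simps)
  then have "\<bar>c' - z\<bar> = \<beta> * \<bar>z - c\<bar>" using assms by (simp add: abs_mult abs_minus_commute)
  also have "\<dots> \<le> \<beta> * r" using z assms by (intro mult_left_mono) auto
  finally have "z \<in> cball c' (\<beta> * r)" by (simp add: dist_real_def)
  then have "good_reply \<beta> c r (cball c' (\<beta> * r))"
    unfolding good_reply_def using pq(1,3) q9 by (intro disjI1 exI[of _ p] exI[of _ q]) (simp add: z_def)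
  then show thesis using that sub by blast
next
  case False
  have "0 < (1 - \<beta>) * r" using assms by simp
  then obtain p q where pq: "least_fraction_in (cball c ((1 - \<beta>) * r)) p q"
    by (rule least_fraction_exists)
  then have "cball (real_of_int p / real_of_int q) (\<beta> * r) \<in> sub_balls \<beta> (cball c r)"
    using assms by (simp add: sub_balls_cball least_fraction_in_def dist_real_def abs_minus_commute)
  moreover have "good_reply \<beta> c r (cball (real_of_int p / real_of_int q) (\<beta> * r))"
    unfolding good_reply_def by (intro disjI2 conjI) (use False in \<open>force simp: not_less\<close>, use pq in blast)
  ultimately show thesis using that by blast
qed

section \<open>Rational approximation of irrationals\<close>

text \<open>By Dirichlet, an irrational has reduced approximations \<open>h / k\<close> with error
  below \<open>1 / k\<^sup>2\<close> for arbitrarily large \<open>k\<close>, so no threshold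
  works.\<close>

lemma Bad_empty:
  assumes "1 \<le> \<delta>"
  shows "Bad \<delta> = {}"
proof -
  have False if x: "x \<in> Bad \<delta>" for x
  proof -
    from x obtain K where K: "\<And>q p::int. K \<le> q \<Longrightarrow> coprime p q \<Longrightarrow>
        \<delta> / (real_of_int q)\<^sup>2 \<le> \<bar>x - real_of_int p / real_of_int q\<bar>" and "x \<notin> \<rat>"
      unfolding Bad_def by auto
    then have "infinite (approx_set x)" using rational_iff_finite_approx_set by blast
    then obtain h k where hk: "(h, k) \<in> approx_set x" "K < k" using infinite_approx_set by blast
    then have "0 < k" "coprime h k" and lt: "\<bar>x - h / k\<bar> < 1 / (real_of_int k)\<^sup>2"
      by (auto simp: approx_set_def)
    have "1 / (real_of_int k)\<^sup>2 \<le> \<delta> / (real_of_int k)\<^sup>2"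
      using assms by (intro divide_right_mono) auto
    then show False using K[of k h] hk \<open>coprime h k\<close> lt by linarith
  qed
  then show ?thesis by blast
qed

text \<open>For each denominator only the nearest numerator matters, which leaves finitely many
  positive distances. This forces rationals very close to \<open>x\<close> to have denominators
  beyond the threshold in \<open>Bad\<close>.\<close>

lemma irrational_far_from_small_denominators:
  fixes x :: real and K :: int
  assumes "x \<notin> \<rat>"
  obtains \<epsilon> where "0 < \<epsilon>"
    "\<And>p q::int. 0 < q \<Longrightarrow> q \<le> K \<Longrightarrow> \<epsilon> \<le> \<bar>x - real_of_int p / real_of_int q\<bar>"
proof -
  define h where "h q = \<bar>x * real_of_int q - of_int (round (x * real_of_int q))\<bar> / real_of_int q" for q :: int
  have pos: "0 < h q" if "0 < q" for q
  proof -
    have "x * real_of_int q \<noteq> of_int (round (x * real_of_int q))"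
    proof
      assume "x * real_of_int q = of_int (round (x * real_of_int q))"
      then have "x = of_int (round (x * real_of_int q)) / of_int q"
        using that by (simp add: field_simps)
      then show False using assms by (metis Rats_divide Rats_of_int)
    qed
    then show ?thesis unfolding h_def using that by auto
  qed
  have le: "h q \<le> \<bar>x - real_of_int p / real_of_int q\<bar>" if "0 < q" for p q
  proof -
    have "\<bar>x * real_of_int q - of_int (round (x * real_of_int q))\<bar> \<le> \<bar>x * real_of_int q - p\<bar>"
      using round_diff_minimal by blast
    also have "x * real_of_int q - p = (x - p / q) * q" using that by (simp add: field_simps)
    also have "\<bar>\<dots>\<bar> = \<bar>x - p / q\<bar> * q" using that by (simp add: abs_mult)
    finally show ?thesis unfolding h_def using that by (simp add: pos_divide_le_eq)
  qed
  \<comment> \<open>The extra 1 keeps the set nonempty when \<open>K < 1\<close>.\<close>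
  define \<epsilon> where "\<epsilon> = Min (insert 1 (h ` {1..K}))"
  have "0 < \<epsilon>" unfolding \<epsilon>_def using pos by (auto simp: Min_gr_iff)
  moreover have "\<epsilon> \<le> \<bar>x - real_of_int p / real_of_int q\<bar>" if "0 < q" "q \<le> K" for p q
  proof -
    have "\<epsilon> \<le> h q" unfolding \<epsilon>_def using that by (intro Min_le) auto
    then show ?thesis using le[OF that(1), of p] by linarith
  qed
  ultimately show thesis using that by blast
qed

section \<open>Growth of denominators along an infinite play\<close>

text \<open>Separates the arithmetic from strategies: \<open>cball (c n) (r n)\<close> are Alice's
  balls, \<open>R\<close> is the radius of the first, and \<open>B n\<close> is Bob's reply.\<close>

lemma good_play_avoids_Bad:
  fixes c r b :: "nat \<Rightarrow> real" and B :: "nat \<Rightarrow> real set"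
  assumes \<beta>: "0 < \<beta>" "\<beta> \<le> 1/3" and R: "0 < R"
    and r: "\<And>n. r n = R * (\<beta> / 2) ^ n"
    and good: "\<And>n. good_reply \<beta> (c n) (r n) (B n)"
    and B: "\<And>n. B n = cball (b n) (\<beta> * r n)"
    and nested: "\<And>n. cball (c (Suc n)) (r (Suc n)) \<subseteq> B n"
    and x: "\<And>n. x \<in> B n"
  shows "x \<notin> Bad (18 * \<beta>)"
proof
  assume "x \<in> Bad (18 * \<beta>)"
  then obtain K where irr: "x \<notin> \<rat>"
    and K: "\<And>q p::int. K \<le> q \<Longrightarrow> coprime p q \<Longrightarrow>
        18 * \<beta> / (real_of_int q)\<^sup>2 \<le> \<bar>x - real_of_int p / real_of_int q\<bar>"
    unfolding Bad_def by auto
  obtain \<epsilon> where \<epsilon>: "0 < \<epsilon>"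
    and far: "\<And>p q::int. 0 < q \<Longrightarrow> q \<le> K \<Longrightarrow> \<epsilon> \<le> \<bar>x - real_of_int p / real_of_int q\<bar>"
    using irrational_far_from_small_denominators[OF irr] by metis
  have r_pos: "0 < r n" for n using r R \<beta> by simp
  have r_Suc: "r (Suc n) = \<beta> * r n / 2" for n by (simp add: r)
  have "(\<lambda>n. R * (\<beta> / 2) ^ n) \<longlonglongrightarrow> R * 0"
    using \<beta> by (intro tendsto_mult tendsto_const LIMSEQ_power_zero) auto
  then have "r \<longlonglongrightarrow> 0" by (simp flip: r)
  then have "\<forall>\<^sub>F n in sequentially. r n < min 1 \<epsilon>"
    using \<epsilon> by (intro order_tendstoD(2)) auto
  then obtain n0 where small: "\<And>n. n0 \<le> n \<Longrightarrow> r n < min 1 \<epsilon>"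
    unfolding eventually_sequentially by blast
  have no_hit: False
    if n: "n0 \<le> n" and q: "0 < q" "coprime p q" "(real_of_int q)\<^sup>2 * r n < 9"
      and mem: "real_of_int p / real_of_int q \<in> B n" for n and p q :: int
  proof -
    have close: "\<bar>x - p / q\<bar> \<le> 2 * \<beta> * r n"
      using mem x[of n] unfolding B by (auto simp: dist_real_def abs_if split: if_splits)
    \<comment> \<open>The distance to \<open>p / q\<close> is thus below \<open>\<epsilon>\<close>,
      so \<open>q > K\<close> and the inequality defining \<open>Bad\<close> applies.\<close>
    have "2 * \<beta> * r n \<le> 1 * r n" using \<beta> r_pos by (intro mult_right_mono) (auto simp: less_imp_le)
    then have "\<not> q \<le> K" using far[OF q(1), of p] close small[OF n] by auto
    then have "18 * \<beta> / (real_of_int q)\<^sup>2 \<le> 2 * \<beta> * r n"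
      using K[of q p] q(2) close by auto
    then have "18 * \<beta> \<le> 2 * \<beta> * r n * (real_of_int q)\<^sup>2"
      using q(1) by (simp add: pos_divide_le_eq)
    also have "\<dots> = 2 * \<beta> * ((real_of_int q)\<^sup>2 * r n)" by simp
    also have "\<dots> < 2 * \<beta> * 9" using q(3) \<beta> by (intro mult_strict_left_mono) auto
    finally show False by simp
  qed
  have "\<exists>P Q. least_fraction_in (cball (c n) ((1 - \<beta>) * r n)) P Q \<and>
        B n = cball (real_of_int P / real_of_int Q) (\<beta> * r n)" if "n0 \<le> n" for n
    using good[of n] no_hit[OF that] unfolding good_reply_def by blast
  then obtain P Q where PQ: "\<And>n. n0 \<le> n \<Longrightarrow>
        least_fraction_in (cball (c n) ((1 - \<beta>) * r n)) (P n) (Q n)"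
    and BPQ: "\<And>n. n0 \<le> n \<Longrightarrow> B n = cball (real_of_int (P n) / real_of_int (Q n)) (\<beta> * r n)"
    by metis
  have Qpos: "0 < Q n" if "n0 \<le> n" for n using PQ[OF that] unfolding least_fraction_in_def by simp
  \<comment> \<open>Alice's radius is half of Bob's, so her ball cannot avoid his centre.\<close>
  have near: "\<bar>c (Suc n) - P n / Q n\<bar> \<le> r (Suc n)" if "n0 \<le> n" for n
    using nested[of n] r_pos[of "Suc n"] unfolding BPQ[OF that]
    by (auto simp: cball_subset_cball_iff dist_real_def r_Suc)
  have large: "9 \<le> (real_of_int (Q n))\<^sup>2 * r (Suc n)" if "n0 \<le> n" for n
  proof -
    have "real_of_int (P n) / real_of_int (Q n) \<in> cball (c (Suc n)) (r (Suc n))"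
      using near[OF that] by (simp add: dist_real_def)
    then show ?thesis
      using good[of "Suc n"] no_hit[of "Suc n"] that Qpos[OF that] unfolding good_reply_def by fastforce
  qed
  have step: "Q (Suc n) \<le> 2 * Q n" if n: "n0 \<le> n" for n
  proof -
    \<comment> \<open>Denominator 1 would give \<open>9 \<le> r (Suc n)\<close>, against
      \<open>r (Suc n) < 1\<close>.\<close>
    have "Q n \<noteq> 1" using large[OF n] small[of "Suc n"] n by auto
    then have Q2: "2 \<le> Q n" using Qpos[OF n] by linarith
    have "(1 - \<beta>) * r (Suc n) \<le> 1 * r (Suc n)" using \<beta> r_pos by (intro mult_right_mono) (auto simp: less_imp_le)
    then have "\<bar>c (Suc n) - P n / Q n\<bar> + (1 - \<beta>) * r (Suc n) \<le> \<beta> * r n"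
      using near[OF n] r_Suc[of n] by linarith
    \<comment> \<open>Equivalent to \<open>\<beta> \<le> 1/3\<close>; this is the source of that
      restriction.\<close>
    also have "\<beta> * r n \<le> ((1 - \<beta>) / 2) * r n"
      using \<beta> r_pos by (intro mult_right_mono) (auto simp: less_imp_le)
    finally have nr: "\<bar>c (Suc n) - P n / Q n\<bar> + (1 - \<beta>) * r (Suc n) \<le> ((1 - \<beta>) * r n) / 2" by simp
    have "9 / (real_of_int (Q n))\<^sup>2 \<le> r (Suc n)"
      using large[OF n] Qpos[OF n] by (simp add: pos_divide_le_eq mult.commute)
    \<comment> \<open>A quarter of \<open>9 / Q\<^sup>2 \<le> r\<close> has to be bounded by
      \<open>2 * (1 - \<beta>) * r\<close>, so 1/8 suffices.\<close>
    moreover have "(1/8) * r (Suc n) \<le> (1 - \<beta>) * r (Suc n)"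
      using \<beta> r_pos by (intro mult_right_mono) (auto simp: less_imp_le)
    ultimately have lg: "9 / (4 * (real_of_int (Q n))\<^sup>2) \<le> 2 * ((1 - \<beta>) * r (Suc n))" by simp
    obtain u w :: int where "0 < w" "w \<le> 2 * Q n"
      "real_of_int u / real_of_int w \<in> cball (c (Suc n)) ((1 - \<beta>) * r (Suc n))"
      using fraction_in_adjacent_interval[OF PQ[OF n] Q2 nr lg] by blast
    then show ?thesis
      using PQ[of "Suc n"] n unfolding least_fraction_in_def by fastforce
  qed
  have growth: "Q (n0 + k) \<le> 2 ^ k * Q n0" for k
  proof (induction k)
    case (Suc k)
    have "Q (Suc (n0 + k)) \<le> 2 * Q (n0 + k)" using step by simp
    with Suc show ?case by simp
  qed simp
  define C where "C = (real_of_int (Q n0))\<^sup>2 * r (Suc n0)"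
  \<comment> \<open>Per round the squared denominator gains at most a factor 4 and the radius a
    factor \<open>\<beta> / 2\<close>, together \<open>2 * \<beta> < 1\<close>.\<close>
  have "9 \<le> C * (2 * \<beta>) ^ k" for k
  proof -
    have "real_of_int (Q (n0 + k)) \<le> of_int (2 ^ k * Q n0)"
      using growth by (simp only: of_int_le_iff)
    then have "(real_of_int (Q (n0 + k)))\<^sup>2 \<le> (2 ^ k * real_of_int (Q n0))\<^sup>2"
      using Qpos[of "n0 + k"] by (intro power_mono) auto
    then have "(real_of_int (Q (n0 + k)))\<^sup>2 * r (Suc (n0 + k)) \<le>
        (2 ^ k * real_of_int (Q n0))\<^sup>2 * r (Suc (n0 + k))"
      by (rule mult_right_mono) (rule less_imp_le[OF r_pos])
    with large[of "n0 + k"] have "9 \<le> (2 ^ k * real_of_int (Q n0))\<^sup>2 * r (Suc (n0 + k))"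
      by (meson le_add1 order_trans)
    also have "r (Suc (n0 + k)) = r (Suc n0) * (\<beta> / 2) ^ k"
      by (simp only: r add_Suc[symmetric] power_add mult.assoc)
    also have "(2 ^ k * real_of_int (Q n0))\<^sup>2 * (r (Suc n0) * (\<beta> / 2) ^ k) = C * ((2 ^ k * 2 ^ k) * (\<beta> / 2) ^ k)"
      by (simp only: C_def power2_eq_square mult_ac)
    also have "(2 ^ k * 2 ^ k) * (\<beta> / 2) ^ k = (2 * 2 * (\<beta> / 2)) ^ k"
      by (simp only: power_mult_distrib)
    also have "2 * 2 * (\<beta> / 2) = 2 * \<beta>" by simp
    finally show ?thesis .
  qed
  moreover have "(\<lambda>k. C * (2 * \<beta>) ^ k) \<longlonglongrightarrow> C * 0"
    using \<beta> by (intro tendsto_mult tendsto_const LIMSEQ_power_zero) auto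
  ultimately have "9 \<le> C * 0" by (intro LIMSEQ_le_const) auto
  then show False by simp
qed

section \<open>The strategy and its limit point\<close>

theorem theorem1p9:
  fixes \<beta> \<delta> :: real
  assumes "0 < \<beta>" and "\<beta> \<le> 1/2" and "\<delta> = 18 * \<beta>"
  shows "ubiquitously_losing (1/2) \<beta> (Bad \<delta>)"
  unfolding ubiquitously_losing_def
proof (intro allI impI)
  fix B1 :: "real set"
  assume "is_closed_ball B1"
  then obtain c0 R0 where R0: "0 < R0" and B1: "B1 = cball c0 R0"
    unfolding is_closed_ball_def by blast
  \<comment> \<open>The reply is a function of a set, so goodness is required for every centre and
    radius describing it; these are unique.\<close>
  define F where "F A = (SOME B. B \<in> sub_balls \<beta> A \<and>
      (\<forall>c r. 0 < r \<and> A = cball c r \<longrightarrow> good_reply \<beta> c r B))" for A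
  have F: "F (cball c r) \<in> sub_balls \<beta> (cball c r) \<and> good_reply \<beta> c r (F (cball c r))"
    if r: "0 < r" for c r
  proof -
    obtain B where B: "B \<in> sub_balls \<beta> (cball c r)" "good_reply \<beta> c r B"
      using good_reply_exists[of r \<beta> c] r assms by auto
    then have "\<exists>B. B \<in> sub_balls \<beta> (cball c r) \<and>
      (\<forall>c' r'. 0 < r' \<and> cball c r = cball c' r' \<longrightarrow> good_reply \<beta> c' r' B)"
      using r by (auto simp: cball_eq_cball_iff intro!: exI[of _ B])
    then show ?thesis unfolding F_def by (rule someI2_ex) (use r in blast)
  qed
  define \<sigma> where "\<sigma> l = F (last l)" for l
  have bob_Suc: "bob_ball B1 \<sigma> A (Suc n) = F (A n)" for A n
    by (simp add: bob_ball_def \<sigma>_def)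
  have bob_0: "bob_ball B1 \<sigma> A 0 = cball c0 R0" for A
    by (simp add: bob_ball_def B1)
  \<comment> \<open>Alice's radius in round \<open>n\<close>, the same in every legal play.\<close>
  define r where "r n = R0 / 2 * (\<beta> / 2) ^ n" for n
  have r_pos: "0 < r n" for n using R0 assms by (simp add: r_def)
  \<comment> \<open>Only the moves up to \<open>n\<close> are assumed legal, because
    \<open>bob_legal\<close> concerns finite plays.\<close>
  have alice: "\<exists>c. A n = cball c (r n)"
    if "\<forall>k\<le>n. A k \<in> sub_balls (1/2) (bob_ball B1 \<sigma> A k)" for A n
    using that
  proof (induction n)
    case 0
    then show ?case using bob_0 R0 sub_ballsE by (auto simp: r_def elim!: sub_ballsE)
  next
    case (Suc n)
    then obtain c where c: "A n = cball c (r n)" by auto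
    then obtain b where b: "F (A n) = cball b (\<beta> * r n)"
      using F[OF r_pos] r_pos sub_ballsE by metis
    have "0 < \<beta> * r n" using assms r_pos by simp
    moreover have "A (Suc n) \<in> sub_balls (1/2) (cball b (\<beta> * r n))"
      using Suc.prems bob_Suc b by (metis order_refl)
    ultimately obtain c' where "A (Suc n) = cball c' (1/2 * (\<beta> * r n))"
      by (metis sub_ballsE)
    then show ?case by (auto simp: r_def mult_ac)
  qed
  have legal: "bob_legal (1/2) \<beta> B1 \<sigma>"
    unfolding bob_legal_def bob_Suc using alice F r_pos by metis
  have win: "\<exists>x. (\<Inter>n. bob_ball B1 \<sigma> A n) = {x} \<and> x \<in> - Bad \<delta>"
    if A: "\<forall>n. A n \<in> sub_balls (1/2) (bob_ball B1 \<sigma> A n)" for A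
  proof -
    let ?B = "bob_ball B1 \<sigma> A"
    obtain c where c: "\<And>n. A n = cball (c n) (r n)" using alice[of _ A] A by metis
    have "\<exists>b. F (A n) = cball b (\<beta> * r n)" for n
      using F[OF r_pos] c r_pos sub_ballsE by metis
    then obtain b where b: "\<And>n. F (A n) = cball (b n) (\<beta> * r n)" by metis
    have AB: "A n \<subseteq> ?B n" for n using A unfolding sub_balls_def by blast
    have FA: "F (A n) \<subseteq> A n" for n using F[OF r_pos] c unfolding sub_balls_def by auto
    have dec: "?B n \<subseteq> ?B m" if "m \<le> n" for m n
      using that by (rule lift_Suc_antimono_le[rotated]) (use bob_Suc FA AB in blast)
    have Suc_shift: "?B (Suc n) = cball (b n) (\<beta> * r n)" for n using bob_Suc b by simp
    have "\<exists>x. \<Inter>(range ?B) = {x}"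
    proof (rule decreasing_closed_nest_sing)
      have "\<exists>z t. 0 < t \<and> ?B n = cball z t" for n
      proof (cases n)
        case 0
        then show ?thesis using bob_0 R0 by blast
      next
        case (Suc m)
        then show ?thesis using Suc_shift assms(1) r_pos by (metis mult_pos_pos)
      qed
      then show "closed (?B n)" "?B n \<noteq> {}" for n
        by (metis closed_cball, metis cball_eq_empty not_less_iff_gr_or_eq)
      show "\<exists>n. \<forall>x\<in>?B n. \<forall>y\<in>?B n. dist x y < \<epsilon>" if "0 < \<epsilon>" for \<epsilon>
      proof -
        \<comment> \<open>The sequence consists of the diameters of
          \<open>?B (Suc n)\<close>.\<close>
        have "(\<lambda>n. 2 * \<beta> * (R0 / 2 * (\<beta> / 2) ^ n)) \<longlonglongrightarrow> 2 * \<beta> * (R0 / 2 * 0)"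
          using assms by (intro tendsto_mult tendsto_const LIMSEQ_power_zero) auto
        then have "\<forall>\<^sub>F n in sequentially. 2 * \<beta> * r n < \<epsilon>"
          using that unfolding r_def by (intro order_tendstoD(2)) auto
        then obtain n where n: "2 * \<beta> * r n < \<epsilon>" unfolding eventually_sequentially by blast
        have "dist x y < \<epsilon>" if "x \<in> ?B (Suc n)" "y \<in> ?B (Suc n)" for x y
          using that n unfolding Suc_shift by (auto simp: dist_real_def abs_if split: if_splits)
        then show ?thesis by blast
      qed
    qed (rule dec)
    then obtain x where x: "(\<Inter>n. ?B n) = {x}" by blast
    have "x \<notin> Bad \<delta>"
    \<comment> \<open>Otherwise \<open>\<delta> > 6\<close>, so \<open>Bad \<delta>\<close> is
      empty.\<close>
    proof (cases "\<beta> \<le> 1/3")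
      case True
      have "x \<in> (\<Inter>n. ?B n)" using x by simp
      then have "x \<in> ?B (Suc n)" for n by blast
      then have mem: "x \<in> F (A n)" for n by (simp only: bob_Suc)
      have "x \<notin> Bad (18 * \<beta>)"
      proof (rule good_play_avoids_Bad[of \<beta> "R0 / 2" r c "\<lambda>n. F (A n)" b])
        show "good_reply \<beta> (c n) (r n) (F (A n))" for n using F[OF r_pos[of n], of "c n"] by (simp only: c)
        show "cball (c (Suc n)) (r (Suc n)) \<subseteq> F (A n)" for n using AB[of "Suc n"] by (simp only: c bob_Suc)
        show "r n = R0 / 2 * (\<beta> / 2) ^ n" for n by (fact r_def)
      qed (use assms(1) True R0 b mem in simp_all)
      then show ?thesis using assms by simp
    next
      case False
      then show ?thesis using Bad_empty[of \<delta>] assms by simp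
    qed
    then show ?thesis using x by (intro exI[of _ x]) simp
  qed
  show "\<exists>\<sigma>. bob_legal (1/2) \<beta> B1 \<sigma> \<and>
      (\<forall>A. (\<forall>n. A n \<in> sub_balls (1/2) (bob_ball B1 \<sigma> A n)) \<longrightarrow>
        (\<exists>x. (\<Inter>n. bob_ball B1 \<sigma> A n) = {x} \<and> x \<in> - Bad \<delta>))" 
    by (rule exI[of _ \<sigma>], rule conjI[OF legal], intro allI impI, rule win)
qed

end
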